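(* Suppose $k,l$ are integers with $l$ even and $kl\neq0$. The map $\mathbb{A}^2(r,y)\to\mathbb{P}^1(r)\times\mathbb{P}^1(t)$ that sends $(r,y)$ to $\big(r,\ \Phi_{-k}(r)\Psi_k(r)(y-r)+2\big)$ induces a birational morphism from $C(k,l)$ to $D(k,l)$.
   Context: $f_j\in\mathbb{Z}[u]$ ($j\in\mathbb{Z}$) is defined by $f_0=0$, $f_1=1$, $f_{j+1}-uf_j+f_{j-1}=0$ (up and down), and $g_j=f_j-f_{j-1}$. For all $j$, $\Phi_{2j}=f_j$ and $\Phi_{2j-1}=g_j$; for all $k$, $\Psi_k=\Phi_{k+1}-\Phi_{k-1}$. $C(k,l)\subset\mathbb{A}^2(r,y)$ (for $l=2n$) is the variety over $\mathbb{Q}$ defined by $f_n(t)\big(\Phi_{-k}(r)\Phi_{k-1}(r)(y-r)-1\big)+f_{n-1}(t)=0$ with $t=\Phi_{-k}(r)\Psi_k(r)(y-r)+2$. $D(k,l)\subset\mathbb{P}^1_{\mathbb{Q}}(r)\times\mathbb{P}^1_{\mathbb{Q}}(t)$ is the projective closure of the affine variety given by $\Phi_{k+1}(r)\Phi_{l-1}(t)=\Phi_{k-1}(r)\Phi_{l+1}(t)$. A morphism is birational if it restricts to an isomorphism from a dense open subset of the source to a dense open subset of the target (the curves need not be irreducible, and both may be empty). *)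

theory Defs
  imports "HOL-Analysis.Abstract_Topology" "HOL-Algebra.Algebraic_Closure_Type"
begin

(* HOL-Algebra's closure operator clashes with the topological one used below. *)
no_notation eq_closure_of (\<open>closure'_of\<index>\<close>)

section \<open>The polynomials\<close>

text \<open>
  The recursion is run upwards from the initial values for positive indices and downwards for
  negative ones; \<open>fpoly_rec\<close> and \<open>fpoly_unique\<close> below confirm that \<open>fpoly\<close> is the unique
  two-sided solution.
\<close>

function fpoly :: "int \<Rightarrow> int poly" where
  "fpoly j =
     (if j = 0 then 0
      else if j = 1 then 1
      else if j > 1 then [:0, 1:] * fpoly (j - 1) - fpoly (j - 2)
      else [:0, 1:] * fpoly (j + 1) - fpoly (j + 2))"
  by auto
termination
  by (relation "measure (\<lambda>j. nat (if j \<ge> 0 then j else 1 - j))") auto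

declare fpoly.simps [simp del]

lemma fpoly_0: "fpoly 0 = 0" and fpoly_1: "fpoly 1 = 1"
  by (simp_all add: fpoly.simps)

lemma fpoly_rec: "fpoly (j + 1) - [:0, 1:] * fpoly j + fpoly (j - 1) = 0"
proof (cases "j \<ge> 1")
  case True
  then show ?thesis by (subst fpoly.simps) simp
next
  case False
  then have "fpoly (j - 1) = [:0, 1:] * fpoly (j - 1 + 1) - fpoly (j - 1 + 2)"
    by (subst fpoly.simps) simp
  then show ?thesis by (simp add: algebra_simps)
qed

lemma fpoly_unique:
  assumes "F 0 = 0" "F 1 = 1" and rec: "\<And>j. F (j + 1) - [:0, 1:] * F j + F (j - 1) = 0"
  shows "F = fpoly"
proof
  fix j :: int
  have up: "F (i + 1) = [:0, 1:] * F i - F (i - 1)" for i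
    using rec[of i] by (simp add: algebra_simps)
  show "F j = fpoly j"
  proof (induction j rule: fpoly.induct)
    case (1 j)
    consider "j = 0" | "j = 1" | "j > 1" | "j < 0" by linarith
    then show ?case
    proof cases
      case 3
      then show ?thesis using 1 up[of "j - 1"] by (simp add: fpoly.simps[of j])
    next
      case 4
      then show ?thesis using 1 up[of "j + 1"] by (simp add: fpoly.simps[of j] add.commute)
    qed (use assms in \<open>simp_all add: fpoly_0 fpoly_1\<close>)
  qed
qed

definition gpoly :: "int \<Rightarrow> int poly" where
  "gpoly j = fpoly j - fpoly (j - 1)"

definition Phi :: "int \<Rightarrow> int poly" where
  "Phi m = (if even m then fpoly (m div 2) else gpoly ((m + 1) div 2))"

lemma Phi_even: "Phi (2 * j) = fpoly j" and Phi_odd: "Phi (2 * j - 1) = gpoly j"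
  by (simp_all add: Phi_def)

definition Psi :: "int \<Rightarrow> int poly" where
  "Psi k = Phi (k + 1) - Phi (k - 1)"


section \<open>Varieties over the rationals\<close>

text \<open>
  A (reduced, possibly reducible or empty) variety over \<open>\<rat>\<close> is represented by its set of points
  over the algebraic closure, together with the Zariski topology whose closed sets are cut out by
  polynomials with rational coefficients, and the functions that are locally quotients of
  polynomials with rational coefficients. With this structure sheaf the morphisms are exactly the
  morphisms of varieties over \<open>\<rat>\<close>.
\<close>

type_synonym qbar = "rat alg_closure"

text \<open>\<open>reg S U\<close> is only meaningful for \<open>U \<subseteq> topspace (zar S)\<close>, and membership of \<open>h\<close> in it
  depends only on the values of \<open>h\<close> on \<open>U\<close>.\<close>

record 'p fun_space =
  zar :: "'p topology"
  reg :: "'p set \<Rightarrow> ('p \<Rightarrow> qbar) set"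

text \<open>In the two ambient spaces below regularity on \<open>U\<close> is expressed by local quotients on \<open>U\<close>
  alone, so it need not be changed on passing to a subset.\<close>

definition subvar :: "'p fun_space \<Rightarrow> 'p set \<Rightarrow> 'p fun_space" where
  "subvar S A = \<lparr>zar = subtopology (zar S) A, reg = reg S\<rparr>"

definition morphism :: "'p fun_space \<Rightarrow> 'q fun_space \<Rightarrow> ('p \<Rightarrow> 'q) \<Rightarrow> bool" where
  "morphism S T \<phi> \<longleftrightarrow>
     continuous_map (zar S) (zar T) \<phi> \<and>
     (\<forall>V h. openin (zar T) V \<and> h \<in> reg T V \<longrightarrow>
        h \<circ> \<phi> \<in> reg S {x \<in> topspace (zar S). \<phi> x \<in> V})"

definition isomorphism :: "'p fun_space \<Rightarrow> 'q fun_space \<Rightarrow> ('p \<Rightarrow> 'q) \<Rightarrow> bool" where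
  "isomorphism S T \<phi> \<longleftrightarrow>
     morphism S T \<phi> \<and>
     (\<exists>\<psi>. morphism T S \<psi> \<and>
        (\<forall>x\<in>topspace (zar S). \<psi> (\<phi> x) = x) \<and>
        (\<forall>y\<in>topspace (zar T). \<phi> (\<psi> y) = y))"

definition dense_open :: "'p fun_space \<Rightarrow> 'p set \<Rightarrow> bool" where
  "dense_open S U \<longleftrightarrow> openin (zar S) U \<and> zar S closure_of U = topspace (zar S)"

definition birational_morphism :: "'p fun_space \<Rightarrow> 'q fun_space \<Rightarrow> ('p \<Rightarrow> 'q) \<Rightarrow> bool" where
  "birational_morphism S T \<phi> \<longleftrightarrow>
     morphism S T \<phi> \<and>
     (\<exists>U V. dense_open S U \<and> dense_open T V \<and> isomorphism (subvar S U) (subvar T V) \<phi>)"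


subsection \<open>The affine plane\<close>

text \<open>Elements of \<open>rat poly poly\<close> are polynomials in the second coordinate with coefficients that
  are polynomials in the first coordinate.\<close>

definition eval2 :: "rat poly poly \<Rightarrow> qbar \<times> qbar \<Rightarrow> qbar" where
  "eval2 p = (\<lambda>(x, y). poly (map_poly (\<lambda>a. poly (map_poly of_rat a) x) p) y)"

definition zariski_A2 :: "(qbar \<times> qbar) topology" where
  "zariski_A2 = topology_generated_by (range (\<lambda>p. {z. eval2 p z \<noteq> 0}))"

definition regular_A2 :: "(qbar \<times> qbar) set \<Rightarrow> (qbar \<times> qbar \<Rightarrow> qbar) set" where
  "regular_A2 U =
     {h. \<forall>z\<in>U. \<exists>W p q. openin zariski_A2 W \<and> z \<in> W \<and>
           (\<forall>w\<in>W \<inter> U. eval2 q w \<noteq> 0 \<and> h w = eval2 p w / eval2 q w)}"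

definition A2 :: "(qbar \<times> qbar) fun_space" where
  "A2 = \<lparr>zar = zariski_A2, reg = regular_A2\<rparr>"


subsection \<open>The product of two projective lines\<close>

text \<open>A point of the projective line is the set of its homogeneous coordinate vectors.\<close>

typedef P1 = "{L. \<exists>x y :: qbar. (x, y) \<noteq> (0, 0) \<and> L = {(c * x, c * y) | c. c \<noteq> 0}}"
  morphisms hcoords Abs_P1
  by (auto intro!: exI[of _ 1])

definition hpoint :: "qbar \<Rightarrow> qbar \<Rightarrow> P1" where
  "hpoint x y = Abs_P1 {(c * x, c * y) | c. c \<noteq> 0}"

lemma hcoords_hpoint:
  "(x, y) \<noteq> (0, 0) \<Longrightarrow> hcoords (hpoint x y) = {(c * x, c * y) | c. c \<noteq> 0}"
  unfolding hpoint_def by (subst Abs_P1_inverse) blast+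

text \<open>Bihomogeneous forms of bidegree \<open>(d, e)\<close> with rational coefficients \<open>c i j\<close>
  (\<open>i \<le> d\<close>, \<open>j \<le> e\<close>).\<close>

definition biform ::
  "nat \<Rightarrow> nat \<Rightarrow> (nat \<Rightarrow> nat \<Rightarrow> rat) \<Rightarrow> (qbar \<times> qbar) \<times> (qbar \<times> qbar) \<Rightarrow> qbar" where
  "biform d e c = (\<lambda>((x0, x1), (y0, y1)).
     \<Sum>i\<le>d. \<Sum>j\<le>e. of_rat (c i j) * (x0 ^ i * x1 ^ (d - i)) * (y0 ^ j * y1 ^ (e - j)))"

definition hcoords2 :: "P1 \<times> P1 \<Rightarrow> ((qbar \<times> qbar) \<times> (qbar \<times> qbar)) set" where
  "hcoords2 = (\<lambda>(P, Q). hcoords P \<times> hcoords Q)"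

definition zariski_P1P1 :: "(P1 \<times> P1) topology" where
  "zariski_P1P1 =
     topology_generated_by {{z. \<forall>v\<in>hcoords2 z. biform d e c v \<noteq> 0} | d e c. True}"

definition regular_P1P1 :: "(P1 \<times> P1) set \<Rightarrow> (P1 \<times> P1 \<Rightarrow> qbar) set" where
  "regular_P1P1 U =
     {h. \<forall>z\<in>U. \<exists>W d e a b. openin zariski_P1P1 W \<and> z \<in> W \<and>
           (\<forall>w\<in>W \<inter> U. \<forall>v\<in>hcoords2 w.
              biform d e b v \<noteq> 0 \<and> h w = biform d e a v / biform d e b v)}"

definition P1P1 :: "(P1 \<times> P1) fun_space" where
  "P1P1 = \<lparr>zar = zariski_P1P1, reg = regular_P1P1\<rparr>"

text \<open>The standard embedding of the affine plane, \<open>(r, t) \<mapsto> ((r : 1), (t : 1))\<close>.\<close>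

definition A2_to_P1P1 :: "qbar \<times> qbar \<Rightarrow> P1 \<times> P1" where
  "A2_to_P1P1 = (\<lambda>(r, t). (hpoint r 1, hpoint t 1))"


section \<open>The two curves\<close>

definition ev :: "int poly \<Rightarrow> qbar \<Rightarrow> qbar" where
  "ev p x = poly (map_poly of_int p) x"

definition t_coord :: "int \<Rightarrow> qbar \<times> qbar \<Rightarrow> qbar" where
  "t_coord k = (\<lambda>(r, y). ev (Phi (- k)) r * ev (Psi k) r * (y - r) + 2)"

text \<open>Only meaningful for even \<open>l\<close>; then \<open>n = l div 2\<close> satisfies \<open>l = 2 * n\<close>.\<close>

definition C_set :: "int \<Rightarrow> int \<Rightarrow> (qbar \<times> qbar) set" where
  "C_set k l = {(r, y).
     let n = l div 2; t = t_coord k (r, y) in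
       ev (fpoly n) t * (ev (Phi (- k)) r * ev (Phi (k - 1)) r * (y - r) - 1)
         + ev (fpoly (n - 1)) t = 0}"

definition curve_C :: "int \<Rightarrow> int \<Rightarrow> (qbar \<times> qbar) fun_space" where
  "curve_C k l = subvar A2 (C_set k l)"

definition D_affine :: "int \<Rightarrow> int \<Rightarrow> (qbar \<times> qbar) set" where
  "D_affine k l = {(r, t).
     ev (Phi (k + 1)) r * ev (Phi (l - 1)) t = ev (Phi (k - 1)) r * ev (Phi (l + 1)) t}"

definition curve_D :: "int \<Rightarrow> int \<Rightarrow> (P1 \<times> P1) fun_space" where
  "curve_D k l = subvar P1P1 (zar P1P1 closure_of (A2_to_P1P1 ` D_affine k l))"

definition CD_map :: "int \<Rightarrow> qbar \<times> qbar \<Rightarrow> P1 \<times> P1" where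
  "CD_map k = (\<lambda>(r, y). (hpoint r 1, hpoint (t_coord k (r, y)) 1))"

end

theory Submission
  imports Defs
begin

text \<open>
  Put \<open>s = \<Phi>\<^sub>-\<^sub>k \<Psi>\<^sub>k\<close>, so that the map is \<open>(r, y) \<mapsto> (r, t)\<close> with \<open>t = s(r) (y - r) + 2\<close>. It changes only
  the second coordinate, by an affine function whose slope \<open>s(r)\<close> depends on \<open>r\<close> alone. Hence it is
  an isomorphism of the open part of the plane where \<open>s(r) \<noteq> 0\<close> onto itself. For \<open>k \<noteq> 0\<close> this part is
  the complement of finitely many vertical lines (\<open>Phi_times_Psi_nonzero\<close>).

  Write \<open>l = 2n\<close>. Since \<open>\<Phi>\<^sub>l\<^sub>+\<^sub>1 = \<Phi>\<^sub>l\<^sub>-\<^sub>1 + (t - 2) f\<^sub>n\<close>, the equation of \<open>D\<close> becomes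
  \<open>\<Psi>\<^sub>k(r) \<Phi>\<^sub>l\<^sub>-\<^sub>1(t) = \<Phi>\<^sub>k\<^sub>-\<^sub>1(r) (t - 2) f\<^sub>n(t)\<close>, and pulling it back along the map gives the equation of \<open>C\<close>
  multiplied by \<open>\<Psi>\<^sub>k(r)\<close> (\<open>D_fun_t_coord\<close>). So the map sends \<open>C\<close> to \<open>D\<close>, and where \<open>s(r) \<noteq> 0\<close> it
  identifies \<open>C\<close> with the affine part of \<open>D\<close>.

  It remains to see that these open parts are dense. A plane curve has no isolated points, so removing
  finitely many vertical lines from it leaves a dense subset as soon as it contains none of the
  lines (\<open>curve_subset_closure_of_generic_fibres\<close>). The curve \<open>C\<close> contains no vertical line because its
  equation has the value \<open>-1\<close> at every point \<open>(r, r)\<close>. On a vertical line contained in the affine part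
  of \<open>D\<close> both \<open>\<Phi>\<^sub>k\<^sub>+\<^sub>1\<close> and \<open>\<Phi>\<^sub>k\<^sub>-\<^sub>1\<close> would vanish at \<open>r\<close>, as \<open>n \<noteq> 0\<close>; the recursion excludes this
  (\<open>D_fun_not_identically_0_on_fibre\<close>). The points of \<open>D\<close> at infinity are limits of affine points by
  definition.

  The remaining work is to see that these maps are morphisms: the affine chart of the product of two
  projective lines is an open embedding (\<open>morphism_on_chart\<close>, \<open>morphism_on_chart_inverse\<close>), by
  homogenizing and dehomogenizing polynomials, and the coordinate changes in the plane are regular
  where their denominators do not vanish (\<open>morphism_on_fibre_coordinate_change\<close>).
\<close>

section \<open>Polynomials vanishing on the generic fibres of a plane curve\<close>

definition fibre :: "'a::comm_ring_1 \<Rightarrow> 'a poly poly \<Rightarrow> 'a poly" where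
  "fibre r F = map_poly (\<lambda>a. poly a r) F"

lemma map_poly_add_hom:
  assumes "h 0 = 0" "\<And>a b. h (a + b) = h a + h b"
  shows "map_poly h (p + q) = map_poly h p + map_poly h q"
  by (intro poly_eqI) (simp add: coeff_map_poly assms)

lemma map_poly_mult_hom:
  fixes h :: "'a::comm_semiring_0 \<Rightarrow> 'b::comm_semiring_0"
  assumes "h 0 = 0" "\<And>a b. h (a + b) = h a + h b" "\<And>a b. h (a * b) = h a * h b"
  shows "map_poly h (p * q) = map_poly h p * map_poly h q"
proof (intro poly_eqI)
  fix n
  have "h (\<Sum>i\<le>n. coeff p i * coeff q (n - i)) = (\<Sum>i\<le>n. h (coeff p i) * h (coeff q (n - i)))"
    using sum_comp_morphism[of h "\<lambda>i. coeff p i * coeff q (n - i)" "{..n}"]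
    by (simp add: assms o_def)
  then show "coeff (map_poly h (p * q)) n = coeff (map_poly h p * map_poly h q) n"
    by (simp add: coeff_map_poly coeff_mult assms(1))
qed

lemma coeff_fibre: "coeff (fibre r F) i = poly (coeff F i) r"
  by (simp add: fibre_def coeff_map_poly)

lemma fibre_add: "fibre r (F + G) = fibre r F + fibre r G"
  by (simp add: fibre_def map_poly_add_hom)

lemma fibre_mult: "fibre r (F * G) = fibre r F * fibre r G"
  by (simp add: fibre_def map_poly_mult_hom)

lemma fibre_smult: "fibre r (smult a F) = smult (poly a r) (fibre r F)"
  by (simp add: fibre_def map_poly_smult)

lemma fibre_power: "fibre r (F ^ n) = fibre r F ^ n"
  by (induction n) (simp_all add: fibre_mult, simp add: fibre_def)

text \<open>
  The Nullstellensatz in one variable: over an algebraically closed field \<open>f\<close> is a constant times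
  a product of \<open>degree f\<close> linear factors, and each of them divides \<open>p\<close>.
\<close>

lemma dvd_power_if_roots_subset:
  fixes f p :: "'a::alg_closed_field poly"
  assumes "f \<noteq> 0" and roots: "\<And>y. poly f y = 0 \<Longrightarrow> poly p y = 0"
  shows "f dvd p ^ degree f"
proof -
  obtain A where A: "size A = degree f" "f = smult (lead_coeff f) (\<Prod>x\<in>#A. [:-x, 1:])"
    using alg_closed_imp_factorization[OF \<open>f \<noteq> 0\<close>] by blast
  have "poly p x = 0" if "x \<in># A" for x
  proof (rule roots)
    have "[:-x, 1:] dvd (\<Prod>x\<in>#A. [:-x, 1:])"
      using that by (intro dvd_prod_mset) auto
    then show "poly f x = 0"
      by (subst A(2)) (simp add: poly_eq_0_iff_dvd dvd_smult)
  qed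
  then have "(\<Prod>x\<in>#A. [:-x, 1:]) dvd p ^ size A"
  proof (induction A)
    case (add x A)
    have "[:-x, 1:] dvd p"
      using add.prems by (simp add: poly_eq_0_iff_dvd)
    moreover have "(\<Prod>x\<in>#A. [:-x, 1:]) dvd p ^ size A"
      using add by simp
    ultimately have "[:-x, 1:] * (\<Prod>x\<in>#A. [:-x, 1:]) dvd p * p ^ size A"
      by (rule mult_dvd_mono)
    then show ?case
      by simp
  qed simp
  then show ?thesis
    using A \<open>f \<noteq> 0\<close> by (metis leading_coeff_0_iff smult_dvd)
qed

text \<open>
  Pseudo-division of \<open>P ^ degree F\<close> by \<open>F\<close> leaves a remainder of smaller degree in the second
  variable. On a generic vertical line the restriction of \<open>F\<close> keeps its degree and divides the
  restriction of \<open>P ^ degree F\<close>, hence also that of the remainder, which is therefore zero there.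
  A polynomial that is zero on infinitely many vertical lines is zero.
\<close>

lemma multiple_of_power_if_vanishing_on_generic_fibres:
  fixes F P :: "'a::{alg_closed_field, field_char_0} poly poly"
  assumes "F \<noteq> 0" "q \<noteq> 0"
    and vanish: "\<And>r y. poly q r \<noteq> 0 \<Longrightarrow> poly (fibre r F) y = 0 \<Longrightarrow> poly (fibre r P) y = 0"
  shows "\<exists>d Q. d \<noteq> 0 \<and> smult d (P ^ degree F) = F * Q"
proof -
  define d where "d = lead_coeff F ^ (Suc (degree (P ^ degree F)) - degree F)"
  obtain Q R where QR: "pseudo_divmod (P ^ degree F) F = (Q, R)" by fastforce
  have eq: "smult d (P ^ degree F) = F * Q + R" and deg: "R = 0 \<or> degree R < degree F"
    using pseudo_divmod[OF \<open>F \<noteq> 0\<close> QR] by (simp_all add: d_def)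
  have "R = 0"
  proof (rule ccontr)
    assume "R \<noteq> 0"
    with deg have deg: "degree R < degree F" by simp
    have "fibre r R = 0" if r: "poly q r \<noteq> 0" "poly (lead_coeff F) r \<noteq> 0" for r
    proof -
      have degF: "degree (fibre r F) = degree F"
        unfolding fibre_def using r(2) by (intro map_poly_degree_eq) simp
      then have "fibre r F \<noteq> 0"
        using deg by auto
      then have "fibre r F dvd fibre r P ^ degree F"
        using dvd_power_if_roots_subset[of "fibre r F" "fibre r P"] vanish[OF r(1)] degF by simp
      moreover have "smult (poly d r) (fibre r P ^ degree F) = fibre r F * fibre r Q + fibre r R"
        using arg_cong[OF eq, of "fibre r"] by (simp add: fibre_add fibre_mult fibre_smult fibre_power)
      ultimately have "fibre r F dvd fibre r R"
        by (metis dvd_add_right_iff dvd_smult dvd_triv_left)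
      moreover have "degree (fibre r R) < degree (fibre r F)"
        unfolding degF using deg map_poly_degree_leq[of "\<lambda>a. poly a r" R] by (simp add: fibre_def)
      ultimately show ?thesis
        using dvd_imp_degree_le leD by blast
    qed
    then have "poly (coeff R i) r = 0 \<or> poly q r = 0 \<or> poly (lead_coeff F) r = 0" for i r
      by (metis coeff_0 coeff_fibre)
    then have "poly (coeff R i * q * lead_coeff F) r = 0" for i r
      by simp
    then have "coeff R i * q * lead_coeff F = 0" for i
      using poly_all_0_iff_0 by blast
    then have "coeff R i = 0" for i
      using \<open>q \<noteq> 0\<close> \<open>F \<noteq> 0\<close> by simp
    then show False
      using \<open>R \<noteq> 0\<close> by (simp add: poly_eq_iff)
  qed
  moreover have "d \<noteq> 0"
    using \<open>F \<noteq> 0\<close> by (simp add: d_def)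
  ultimately show ?thesis
    using eq by auto
qed

text \<open>
  If \<open>d\<close> vanishes at \<open>r\<close>, then on the line over \<open>r\<close> the product \<open>F * Q\<close> vanishes while \<open>F\<close> does
  not, so \<open>Q\<close> does, and a linear factor can be cancelled from \<open>d\<close> and \<open>Q\<close>.
\<close>

lemma multiplier_nonzero_at_if_fibre_nonzero:
  fixes F G :: "'a::field poly poly"
  assumes "d \<noteq> 0" "smult d G = F * Q" "fibre r F \<noteq> 0"
  shows "\<exists>d Q. poly d r \<noteq> 0 \<and> smult d G = F * Q"
  using assms
proof (induction "degree d" arbitrary: d Q rule: less_induct)
  case less
  show ?case
  proof (cases "poly d r = 0")
    case False
    then show ?thesis using less.prems by blast
  next
    case True
    then obtain d' where d': "d = [:-r, 1:] * d'"
      unfolding poly_eq_0_iff_dvd by (auto elim: dvdE)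
    have "d' \<noteq> 0" using less.prems(1) d' by auto
    have "fibre r F * fibre r Q = 0"
      using arg_cong[OF less.prems(2), of "fibre r"] True by (simp add: fibre_mult fibre_smult)
    then have "fibre r Q = 0"
      using less.prems(3) by simp
    then have "[:-r, 1:] dvd coeff Q i" for i
      using coeff_fibre[of r Q i] by (simp add: poly_eq_0_iff_dvd)
    then have "[:[:-r, 1:]:] dvd Q"
      by (simp add: const_poly_dvd_iff)
    then obtain Q' where Q': "Q = smult [:-r, 1:] Q'"
      by (auto elim: dvdE)
    have "smult [:-r, 1:] (smult d' G - F * Q') = 0"
      using less.prems(2) unfolding d' Q' by (simp add: smult_diff_right del: smult_pCons)
    then have "smult d' G = F * Q'"
      by (simp del: smult_pCons)
    moreover have "degree d' < degree d"
      unfolding d' using \<open>d' \<noteq> 0\<close> by (subst degree_mult_eq) auto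
    ultimately show ?thesis
      using less.hyps \<open>d' \<noteq> 0\<close> less.prems(3) by blast
  qed
qed

text \<open>
  The algebraic core of both density statements: a plane curve that does not contain the vertical
  line over \<open>r\<close> has no isolated points on it. A power of \<open>P\<close> times some \<open>d\<close> with \<open>d(r) \<noteq> 0\<close>,
  a polynomial in the first variable alone, is a multiple of \<open>F\<close>; evaluating at the point gives
  the claim.
\<close>

lemma vanishing_extends_over_special_fibres:
  fixes F P :: "'a::{alg_closed_field, field_char_0} poly poly"
  assumes "q \<noteq> 0" "fibre r F \<noteq> 0" "poly (fibre r F) y = 0"
    and vanish: "\<And>r y. poly q r \<noteq> 0 \<Longrightarrow> poly (fibre r F) y = 0 \<Longrightarrow> poly (fibre r P) y = 0"
  shows "poly (fibre r P) y = 0"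
proof -
  have "F \<noteq> 0"
    using assms(2) by (auto simp: fibre_def)
  then obtain d Q where "poly d r \<noteq> 0" and eq: "smult d (P ^ degree F) = F * Q"
    using multiple_of_power_if_vanishing_on_generic_fibres[OF _ \<open>q \<noteq> 0\<close> vanish]
      multiplier_nonzero_at_if_fibre_nonzero[OF _ _ assms(2)] by metis
  have "poly d r * poly (fibre r P) y ^ degree F = 0"
    using arg_cong[OF eq, of "\<lambda>G. poly (fibre r G) y"] assms(3)
    by (simp add: fibre_mult fibre_smult fibre_power)
  then show ?thesis
    using \<open>poly d r \<noteq> 0\<close> by simp
qed

section \<open>Polynomial functions and the Zariski topology of the plane\<close>

definition polyfun :: "(qbar \<times> qbar \<Rightarrow> qbar) set" where
  "polyfun = range eval2"

lemma of_rat_poly_add: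
  "map_poly of_rat (a + b) = (map_poly of_rat a + map_poly of_rat b :: qbar poly)"
  by (simp add: map_poly_add_hom of_rat_add)

lemma of_rat_poly_mult:
  "map_poly of_rat (a * b) = (map_poly of_rat a * map_poly of_rat b :: qbar poly)"
  by (simp add: map_poly_mult_hom of_rat_add of_rat_mult)

lemma eval2_eq_fibre: "eval2 p (x, y) = poly (fibre x (map_poly (map_poly of_rat) p)) y"
  by (simp add: eval2_def fibre_def map_poly_map_poly o_def)

lemma eval2_add: "eval2 (p + q) w = eval2 p w + eval2 q w"
  by (cases w) (simp add: eval2_eq_fibre map_poly_add_hom of_rat_poly_add fibre_add)

lemma eval2_mult: "eval2 (p * q) w = eval2 p w * eval2 q w"
  by (cases w) (simp add: eval2_eq_fibre map_poly_mult_hom of_rat_poly_add of_rat_poly_mult fibre_mult)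

lemma polyfun_eval2 [intro]: "eval2 p \<in> polyfun"
  by (simp add: polyfun_def)

lemma polyfun_add [intro]: "f \<in> polyfun \<Longrightarrow> g \<in> polyfun \<Longrightarrow> (\<lambda>w. f w + g w) \<in> polyfun"
  unfolding polyfun_def by (clarsimp simp: eval2_add[symmetric])

lemma polyfun_mult [intro]: "f \<in> polyfun \<Longrightarrow> g \<in> polyfun \<Longrightarrow> (\<lambda>w. f w * g w) \<in> polyfun"
  unfolding polyfun_def by (clarsimp simp: eval2_mult[symmetric])

lemma polyfun_of_rat [intro]: "(\<lambda>_. of_rat c) \<in> polyfun"
proof -
  have "eval2 [:[:c:]:] = (\<lambda>_. of_rat c)"
    by (auto simp: eval2_def map_poly_pCons)
  then show ?thesis by (metis polyfun_eval2)
qed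

lemma polyfun_of_int [intro]: "(\<lambda>_. of_int c) \<in> polyfun"
  using polyfun_of_rat[of "of_int c"] by simp

lemma polyfun_fst [intro]: "fst \<in> polyfun"
proof -
  have "eval2 [:[:0, 1:]:] = fst"
    by (auto simp: eval2_def map_poly_pCons)
  then show ?thesis by (metis polyfun_eval2)
qed

lemma polyfun_snd [intro]: "snd \<in> polyfun"
proof -
  have "eval2 [:0, 1:] = snd"
    by (auto simp: eval2_def map_poly_pCons)
  then show ?thesis by (metis polyfun_eval2)
qed

lemma polyfun_diff [intro]: "f \<in> polyfun \<Longrightarrow> g \<in> polyfun \<Longrightarrow> (\<lambda>w. f w - g w) \<in> polyfun"
  using polyfun_add[OF _ polyfun_mult[OF polyfun_of_int[of "-1"]], of f g] by simp

lemma polyfun_power [intro]: "f \<in> polyfun \<Longrightarrow> (\<lambda>w. f w ^ n) \<in> polyfun"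
  by (induction n) (use polyfun_of_int[of 1] in auto)

lemma polyfun_sum [intro]: "(\<And>i. i \<in> I \<Longrightarrow> f i \<in> polyfun) \<Longrightarrow> (\<lambda>w. \<Sum>i\<in>I. f i w) \<in> polyfun"
  by (induction I rule: infinite_finite_induct) (use polyfun_of_int[of 0] in auto)

lemma ev_pCons: "ev (pCons a p) x = of_int a + x * ev p x"
  by (simp add: ev_def map_poly_pCons)

lemma polyfun_ev [intro]: "f \<in> polyfun \<Longrightarrow> (\<lambda>w. ev p (f w)) \<in> polyfun"
proof (induction p)
  case 0
  then show ?case using polyfun_of_int[of 0] by (simp add: ev_def)
next
  case (pCons a p)
  then show ?case by (simp add: ev_pCons polyfun_add polyfun_mult polyfun_of_int)
qed

lemma openin_zariski_A2_nonzero: "f \<in> polyfun \<Longrightarrow> openin zariski_A2 {w. f w \<noteq> 0}"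
  unfolding zariski_A2_def polyfun_def by (rule topology_generated_by_Basis) auto

text \<open>
  The nonvanishing sets of polynomials are given only as a subbasis, but the product of two
  polynomials shows that they form a basis.
\<close>

lemma zariski_A2_basis:
  assumes "openin zariski_A2 W" "z \<in> W"
  obtains f where "f \<in> polyfun" "f z \<noteq> 0" "{w. f w \<noteq> 0} \<subseteq> W"
proof -
  have "generate_topology_on (range (\<lambda>p. {z. eval2 p z \<noteq> 0})) W"
    using assms(1) by (simp add: zariski_A2_def openin_topology_generated_by_iff)
  then have "\<exists>f\<in>polyfun. f z \<noteq> 0 \<and> {w. f w \<noteq> 0} \<subseteq> W"
    using assms(2)
  proof induction
    case (Int W V)
    then obtain f g where "f \<in> polyfun" "g \<in> polyfun" "f z \<noteq> 0" "g z \<noteq> 0"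
      "{w. f w \<noteq> 0} \<subseteq> W" "{w. g w \<noteq> 0} \<subseteq> V"
      by blast
    then show ?case
      by (intro bexI[of _ "\<lambda>w. f w * g w"]) auto
  next
    case (UN K)
    then obtain k where "k \<in> K" "z \<in> k" by blast
    then show ?case using UN.IH[of k] by blast
  qed (auto simp: polyfun_def)
  then show ?thesis using that by blast
qed

lemma topspace_zariski_A2 [simp]: "topspace zariski_A2 = UNIV"
proof -
  have "{w. (1::qbar) \<noteq> 0} \<subseteq> topspace zariski_A2"
    using openin_zariski_A2_nonzero[OF polyfun_of_int[of 1]] openin_subset by fastforce
  then show ?thesis by auto
qed

lemma regular_A2_iff:
  "h \<in> regular_A2 U \<longleftrightarrow>
    (\<forall>z\<in>U. \<exists>W. openin zariski_A2 W \<and> z \<in> W \<and>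
      (\<exists>f\<in>polyfun. \<exists>g\<in>polyfun. \<forall>w\<in>W \<inter> U. g w \<noteq> 0 \<and> h w = f w / g w))"
  unfolding regular_A2_def polyfun_def by simp

lemma regular_A2E:
  assumes "h \<in> regular_A2 U" "z \<in> U"
  obtains W f g where "openin zariski_A2 W" "z \<in> W" "f \<in> polyfun" "g \<in> polyfun"
    "\<And>w. w \<in> W \<inter> U \<Longrightarrow> g w \<noteq> 0 \<and> h w = f w / g w"
proof -
  obtain W p q where "openin zariski_A2 W" "z \<in> W"
    "\<forall>w\<in>W \<inter> U. eval2 q w \<noteq> 0 \<and> h w = eval2 p w / eval2 q w"
    using assms unfolding regular_A2_def by blast
  then show thesis
    using that[of W "eval2 p" "eval2 q"] polyfun_eval2 by blast
qed

text \<open>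
  A basic neighbourhood that meets the curve but misses its generic fibres is the nonvanishing set of
  a polynomial that vanishes on the generic fibres, hence on the whole curve.
\<close>

lemma curve_subset_closure_of_generic_fibres:
  assumes "f \<in> polyfun" "s \<noteq> 0" and no_vertical_line: "\<And>r. \<exists>y. f (r, y) \<noteq> 0"
  shows "{w. f w = 0} \<subseteq> zariski_A2 closure_of {w. f w = 0 \<and> ev s (fst w) \<noteq> 0}"
proof
  fix z assume "z \<in> {w. f w = 0}"
  obtain r y where z: "z = (r, y)" by (cases z)
  obtain p where p: "f = eval2 p"
    using assms(1) by (auto simp: polyfun_def)
  define F :: "qbar poly poly" where "F = map_poly (map_poly of_rat) p"
  have F: "poly (fibre r F) y = f (r, y)" for r y
    by (simp add: p F_def eval2_eq_fibre)
  have "\<exists>w. (f w = 0 \<and> ev s (fst w) \<noteq> 0) \<and> w \<in> W"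
    if W: "openin zariski_A2 W" "z \<in> W" for W
  proof (rule ccontr)
    assume none: "\<not> (\<exists>w. (f w = 0 \<and> ev s (fst w) \<noteq> 0) \<and> w \<in> W)"
    obtain g where g: "g \<in> polyfun" "g z \<noteq> 0" "{w. g w \<noteq> 0} \<subseteq> W"
      using zariski_A2_basis[OF W] by blast
    obtain u where u: "g = eval2 u"
      using g(1) by (auto simp: polyfun_def)
    define G :: "qbar poly poly" where "G = map_poly (map_poly of_rat) u"
    have G: "poly (fibre r G) y = g (r, y)" for r y
      by (simp add: u G_def eval2_eq_fibre)
    have "poly (fibre r G) y = 0"
    proof (rule vanishing_extends_over_special_fibres)
      show "map_poly of_int s \<noteq> (0 :: qbar poly)"
        using \<open>s \<noteq> 0\<close> by (subst map_poly_eq_0_iff) auto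
      show "fibre r F \<noteq> 0"
        using no_vertical_line[of r] F[of r] by auto
      show "poly (fibre r F) y = 0"
        using \<open>z \<in> {w. f w = 0}\<close> by (simp add: F z)
      show "poly (fibre r G) y = 0"
        if "poly (map_poly of_int s) r \<noteq> 0" "poly (fibre r F) y = 0" for r y
        using that none g(3) unfolding F G ev_def by force
    qed
    then show False
      using g(2) by (simp add: G z)
  qed
  then show "z \<in> zariski_A2 closure_of {w. f w = 0 \<and> ev s (fst w) \<noteq> 0}"
    by (simp add: in_closure_of)
qed

section \<open>Morphisms defined on a subset\<close>

text \<open>
  A morphism on the subset \<open>A\<close>, phrased so that it restricts to arbitrary subsets of the source and
  target. The sets \<open>Z\<close> and \<open>Z'\<close> are not required to be open, because open sets of subvarieties
  are not open in the ambient space.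
\<close>

definition morphism_on :: "'p fun_space \<Rightarrow> 'q fun_space \<Rightarrow> 'p set \<Rightarrow> ('p \<Rightarrow> 'q) \<Rightarrow> bool" where
  "morphism_on S T A \<phi> \<longleftrightarrow>
     continuous_map (subtopology (zar S) A) (zar T) \<phi> \<and>
     (\<forall>Z Z' h. Z \<subseteq> A \<and> \<phi> ` Z \<subseteq> Z' \<and> h \<in> reg T Z' \<longrightarrow> h \<circ> \<phi> \<in> reg S Z)"

lemma reg_compose_morphism_on:
  assumes "morphism_on S T A \<phi>" "h \<in> reg T Z'" "Z \<subseteq> A" "\<phi> ` Z \<subseteq> Z'"
  shows "h \<circ> \<phi> \<in> reg S Z"
  using assms unfolding morphism_on_def by blast

lemma morphism_onI:
  assumes "continuous_map (subtopology (zar S) A) (zar T) \<phi>"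
    and "\<And>Z Z' h. Z \<subseteq> A \<Longrightarrow> \<phi> ` Z \<subseteq> Z' \<Longrightarrow> h \<in> reg T Z' \<Longrightarrow> h \<circ> \<phi> \<in> reg S Z"
  shows "morphism_on S T A \<phi>"
  unfolding morphism_on_def by (intro conjI allI impI; (elim conjE)?) (rule assms; assumption?)+

lemma morphism_on_subset:
  assumes "morphism_on S T A \<phi>" "B \<subseteq> A"
  shows "morphism_on S T B \<phi>"
proof (rule morphism_onI)
  show "continuous_map (subtopology (zar S) B) (zar T) \<phi>"
    using assms unfolding morphism_on_def by (auto intro: continuous_map_from_subtopology_mono)
qed (use assms(2) in \<open>blast intro: reg_compose_morphism_on[OF assms(1)]\<close>)

lemma morphism_on_compose:
  assumes \<phi>: "morphism_on S T A \<phi>" and \<chi>: "morphism_on T U B \<chi>" and "\<phi> ` A \<subseteq> B"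
  shows "morphism_on S U A (\<chi> \<circ> \<phi>)"
proof -
  have "continuous_map (subtopology (zar S) A) (subtopology (zar T) B) \<phi>"
    using \<phi> \<open>\<phi> ` A \<subseteq> B\<close> unfolding morphism_on_def
    by (auto intro!: continuous_map_into_subtopology)
  moreover have "h \<circ> (\<chi> \<circ> \<phi>) \<in> reg S Z"
    if "Z \<subseteq> A" "(\<chi> \<circ> \<phi>) ` Z \<subseteq> Z'" "h \<in> reg U Z'" for Z Z' h
  proof -
    have h\<chi>: "h \<circ> \<chi> \<in> reg T (\<phi> ` Z)"
      using that \<open>\<phi> ` A \<subseteq> B\<close> by (intro reg_compose_morphism_on[OF \<chi>]) auto
    then show ?thesis
      using reg_compose_morphism_on[OF \<phi> h\<chi> that(1)] by (simp add: comp_assoc)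
  qed
  moreover have "continuous_map (subtopology (zar T) B) (zar U) \<chi>"
    using \<chi> by (simp add: morphism_on_def)
  ultimately show ?thesis
    by (intro morphism_onI) (rule continuous_map_compose)
qed

lemma morphism_subvar:
  assumes "morphism_on S T A \<phi>" "Z \<subseteq> A" "\<phi> ` Z \<subseteq> Z'"
  shows "morphism (subvar S Z) (subvar T Z') \<phi>"
proof -
  have "continuous_map (subtopology (zar S) Z) (subtopology (zar T) Z') \<phi>"
    using assms unfolding morphism_on_def
    by (auto intro!: continuous_map_into_subtopology intro: continuous_map_from_subtopology_mono)
  moreover have "h \<circ> \<phi> \<in> reg S {x \<in> topspace (subtopology (zar S) Z). \<phi> x \<in> V}"
    if "h \<in> reg T V" for V h
    using assms(2) that by (intro reg_compose_morphism_on[OF assms(1)]) auto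
  ultimately show ?thesis
    by (simp add: morphism_def subvar_def)
qed

lemma isomorphism_subvar:
  assumes "morphism (subvar S A) (subvar T B) \<phi>" "morphism (subvar T B) (subvar S A) \<psi>"
    and "\<And>x. x \<in> A \<Longrightarrow> \<psi> (\<phi> x) = x" "\<And>y. y \<in> B \<Longrightarrow> \<phi> (\<psi> y) = y"
  shows "isomorphism (subvar S A) (subvar T B) \<phi>"
  unfolding isomorphism_def using assms by (intro conjI exI[of _ \<psi>]) (simp_all add: subvar_def)

lemma dense_open_subvar:
  assumes "openin (subtopology (zar S) Z) U" "Z \<subseteq> zar S closure_of U"
  shows "dense_open (subvar S Z) U"
proof -
  have "U \<subseteq> Z" using openin_subset[OF assms(1)] by simp
  then have "Z \<inter> U = U" by blast
  moreover have "Z \<subseteq> topspace (zar S)"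
    using assms(2) closure_of_subset_topspace by fastforce
  ultimately show ?thesis
    using assms by (simp add: dense_open_def subvar_def closure_of_subtopology inf_absorb1 inf_absorb2)
qed

lemma subvar_subvar: "subvar (subvar S A) B = subvar S (A \<inter> B)"
  by (simp add: subvar_def subtopology_subtopology)

text \<open>
  The exponent may be any sufficiently large \<open>m\<close>, so that for a quotient the same power of \<open>s\<close> can
  be used in the numerator and in the denominator, where it cancels.
\<close>

lemma morphism_on_if_denominators_clear:
  assumes s: "s \<in> polyfun" "\<And>w. w \<in> A \<Longrightarrow> s w \<noteq> 0" and A: "openin zariski_A2 A"
    and clear: "\<And>f. f \<in> polyfun \<Longrightarrow>
      \<exists>N. \<forall>m\<ge>N. \<exists>g\<in>polyfun. \<forall>w\<in>A. g w = s w ^ m * f (\<phi> w)"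
  shows "morphism_on A2 A2 A \<phi>"
proof -
  have cont: "continuous_map (subtopology zariski_A2 A) zariski_A2 \<phi>"
  proof -
    have "openin (subtopology zariski_A2 A) (\<phi> -` {z. eval2 p z \<noteq> 0} \<inter> A)" for p
    proof -
      obtain N where "\<forall>m\<ge>N. \<exists>g\<in>polyfun. \<forall>w\<in>A. g w = s w ^ m * eval2 p (\<phi> w)"
        using clear[OF polyfun_eval2] ..
      then obtain g where g: "g \<in> polyfun" "\<And>w. w \<in> A \<Longrightarrow> g w = s w ^ N * eval2 p (\<phi> w)"
        by (meson order_refl)
      have "\<phi> -` {z. eval2 p z \<noteq> 0} \<inter> A = {w. g w \<noteq> 0} \<inter> A"
        using g(2) s(2) by auto
      then show ?thesis
        using openin_zariski_A2_nonzero[OF g(1)] by (auto simp: openin_subtopology)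
    qed
    moreover have "eval2 [:[:1:]:] z \<noteq> 0" for z
      by (cases z) (simp add: eval2_def map_poly_pCons)
    ultimately show ?thesis
      unfolding zariski_A2_def continuous_on_generated_topo_iff
      unfolding zariski_A2_def[symmetric] by auto
  qed
  moreover have "h \<circ> \<phi> \<in> regular_A2 Z"
    if Z: "Z \<subseteq> A" "\<phi> ` Z \<subseteq> Z'" and h: "h \<in> regular_A2 Z'" for Z Z' h
    unfolding regular_A2_iff
  proof
    fix z assume "z \<in> Z"
    with Z have "\<phi> z \<in> Z'" by blast
    then obtain W f g where W: "openin zariski_A2 W" "\<phi> z \<in> W"
      and fg: "f \<in> polyfun" "g \<in> polyfun"
      and h: "\<And>w. w \<in> W \<inter> Z' \<Longrightarrow> g w \<noteq> 0 \<and> h w = f w / g w"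
      by (rule regular_A2E[OF h]) (rule that)
    obtain M where "\<forall>m\<ge>M. \<exists>g\<in>polyfun. \<forall>w\<in>A. g w = s w ^ m * f (\<phi> w)"
      using clear[OF fg(1)] ..
    moreover obtain N where "\<forall>m\<ge>N. \<exists>f\<in>polyfun. \<forall>w\<in>A. f w = s w ^ m * g (\<phi> w)"
      using clear[OF fg(2)] ..
    ultimately obtain f' g' where f'g': "f' \<in> polyfun" "g' \<in> polyfun"
      "\<And>w. w \<in> A \<Longrightarrow> f' w = s w ^ max M N * f (\<phi> w)"
      "\<And>w. w \<in> A \<Longrightarrow> g' w = s w ^ max M N * g (\<phi> w)"
      by (metis max.cobounded1 max.cobounded2)
    let ?W = "{w \<in> A. \<phi> w \<in> W}"
    have "openin zariski_A2 ?W"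
      using openin_continuous_map_preimage[OF cont W(1)] A
      by (auto simp: openin_open_subtopology)
    moreover have "g' w \<noteq> 0 \<and> (h \<circ> \<phi>) w = f' w / g' w" if "w \<in> ?W \<inter> Z" for w
      using that h[of "\<phi> w"] f'g'(3,4)[of w] s(2)[of w] Z by (auto simp: field_simps)
    ultimately show "\<exists>W. openin zariski_A2 W \<and> z \<in> W \<and>
        (\<exists>f\<in>polyfun. \<exists>g\<in>polyfun. \<forall>w\<in>W \<inter> Z. g w \<noteq> 0 \<and> (h \<circ> \<phi>) w = f w / g w)"
      using \<open>z \<in> Z\<close> Z(1) W(2)
      by (intro exI[of _ ?W] conjI) (blast, blast, rule bexI[OF bexI[OF _ f'g'(2)] f'g'(1)], blast)
  qed
  ultimately show ?thesis
    by (intro morphism_onI) (simp_all add: A2_def)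
qed

text \<open>
  Horner's scheme in the second coordinate.
\<close>

lemma polyfun_induct [consumes 1, case_names zero coeff]:
  assumes "f \<in> polyfun"
    and "P (\<lambda>_. 0)"
    and coeff: "\<And>a f. P f \<Longrightarrow> P (\<lambda>w. poly (map_poly of_rat a) (fst w) + snd w * f w)"
  shows "P f"
proof -
  have "P (eval2 p)" for p
  proof (induction p)
    case 0
    have "eval2 0 = (\<lambda>_. 0)" by (auto simp: eval2_def)
    then show ?case using assms(2) by simp
  next
    case (pCons a p)
    have "eval2 (pCons a p) = (\<lambda>w. poly (map_poly of_rat a) (fst w) + snd w * eval2 p w)"
      by (auto simp: eval2_def map_poly_pCons)
    then show ?case using coeff[OF pCons.IH] by simp
  qed
  then show ?thesis using assms(1) by (auto simp: polyfun_def)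
qed

lemma polyfun_of_fst: "(\<lambda>w. poly (map_poly of_rat a) (fst w)) \<in> polyfun"
proof -
  have "eval2 [:a:] = (\<lambda>w. poly (map_poly of_rat a) (fst w))"
    by (auto simp: eval2_def map_poly_pCons)
  then show ?thesis by (metis polyfun_eval2)
qed

text \<open>
  Maps that change only the second coordinate, by a fraction \<open>g / s\<close>. This covers both the map of
  the proposition (with \<open>s = 1\<close>) and its inverse. Each Horner step costs one more factor \<open>s\<close>.
\<close>

lemma morphism_on_fibre_coordinate_change:
  assumes s: "s \<in> polyfun" and g: "g \<in> polyfun"
  shows "morphism_on A2 A2 {w. s w \<noteq> 0} (\<lambda>w. (fst w, g w / s w))"
proof (rule morphism_on_if_denominators_clear[OF s])
  fix f assume "f \<in> polyfun"
  then show "\<exists>N. \<forall>m\<ge>N. \<exists>f'\<in>polyfun. \<forall>w\<in>{w. s w \<noteq> 0}. f' w = s w ^ m * f (fst w, g w / s w)"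
  proof (induction rule: polyfun_induct)
    case zero
    show ?case using polyfun_of_int[of 0] by auto
  next
    case (coeff a f)
    then obtain N where N: "\<And>m. m \<ge> N \<Longrightarrow>
        \<exists>f'\<in>polyfun. \<forall>w\<in>{w. s w \<noteq> 0}. f' w = s w ^ m * f (fst w, g w / s w)"
      by blast
    show ?case
    proof (intro exI[of _ "Suc N"] allI impI)
      fix m assume "Suc N \<le> m"
      then obtain m' where m': "m = Suc m'" "N \<le> m'" by (cases m) auto
      obtain f' where f': "f' \<in> polyfun"
        "\<And>w. s w \<noteq> 0 \<Longrightarrow> f' w = s w ^ m' * f (fst w, g w / s w)"
        using N[OF m'(2)] by blast
      let ?f = "\<lambda>w. s w ^ m * poly (map_poly of_rat a) (fst w) + g w * f' w"
      have "?f \<in> polyfun"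
        by (intro polyfun_add polyfun_mult polyfun_power polyfun_of_fst s g f')
      moreover have "?f w = s w ^ m * (poly (map_poly of_rat a) (fst w) + g w / s w * f (fst w, g w / s w))"
        if "s w \<noteq> 0" for w
        using that by (simp add: f'(2)[OF that] m'(1) distrib_left)
      ultimately show "\<exists>f'\<in>polyfun. \<forall>w\<in>{w. s w \<noteq> 0}. f' w = s w ^ m *
          (poly (map_poly of_rat a) (fst (fst w, g w / s w)) +
            snd (fst w, g w / s w) * f (fst w, g w / s w))"
        unfolding fst_conv snd_conv by (intro bexI[of _ ?f]) blast+
    qed
  qed
qed (use openin_zariski_A2_nonzero[OF s] in simp_all)

section \<open>The affine chart of the product of two projective lines\<close>

lemma hcoords2_nonempty: "hcoords2 z \<noteq> {}"
  using hcoords[of "fst z"] hcoords[of "snd z"] zero_neq_one[where 'a = qbar]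
  by (cases z) (auto simp: hcoords2_def simp del: zero_neq_one)

lemma hpoint_eq_if_mem_hcoords:
  assumes "(x, y) \<in> hcoords P"
  shows "P = hpoint x y"
proof -
  obtain a b where ab: "(a, b) \<noteq> (0, 0)" "hcoords P = {(c * a, c * b) | c. c \<noteq> 0}"
    using hcoords[of P] by auto
  then obtain e where e: "e \<noteq> 0" "x = e * a" "y = e * b"
    using assms by auto
  have "hcoords (hpoint x y) = {(c * x, c * y) | c. c \<noteq> 0}"
    using ab(1) e by (intro hcoords_hpoint) auto
  also have "\<dots> = hcoords P"
  proof -
    have "\<exists>c'. c * a = c' * x \<and> c * b = c' * y \<and> c' \<noteq> 0" if "c \<noteq> 0" for c
      using e that by (intro exI[of _ "c / e"]) auto
    then show ?thesis
      using e by (fastforce simp: ab(2))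
  qed
  finally show ?thesis
    by (simp add: hcoords_inject)
qed

lemma mem_hcoords_scale:
  assumes "(x, y) \<in> hcoords P" "c \<noteq> 0"
  shows "(c * x, c * y) \<in> hcoords P"
proof -
  obtain a b where P: "hcoords P = {(c * a, c * b) | c. c \<noteq> 0}"
    using hcoords[of P] by auto
  then obtain c' where "c' \<noteq> 0" "x = c' * a" "y = c' * b"
    using assms(1) by auto
  then show ?thesis
    unfolding P using assms(2) by (auto intro!: exI[of _ "c * c'"])
qed

lemma hcoords2_chart:
  "hcoords2 (A2_to_P1P1 (r, t)) = {((a * r, a), (b * t, b)) | a b. a \<noteq> 0 \<and> b \<noteq> 0}"
  by (auto simp: A2_to_P1P1_def hcoords2_def hcoords_hpoint)

lemma chart_eq_if_mem_hcoords2: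
  assumes "((x0, x1), (y0, y1)) \<in> hcoords2 z" "x1 \<noteq> 0" "y1 \<noteq> 0"
  shows "z = A2_to_P1P1 (x0 / x1, y0 / y1)"
proof -
  obtain P Q where z: "z = (P, Q)" by (cases z)
  have "(x0 / x1, 1) \<in> hcoords P" "(y0 / y1, 1) \<in> hcoords Q"
    using assms mem_hcoords_scale[of x0 x1 P "1 / x1"] mem_hcoords_scale[of y0 y1 Q "1 / y1"]
    by (auto simp: z hcoords2_def)
  then show ?thesis
    by (auto simp: z A2_to_P1P1_def dest: hpoint_eq_if_mem_hcoords)
qed

lemma normalized_mem_hcoords2: "((fst w, 1), (snd w, 1)) \<in> hcoords2 (A2_to_P1P1 w)"
  by (cases w) (auto simp: hcoords2_chart intro!: exI[of _ 1])

lemma inj_chart: "inj A2_to_P1P1"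
proof (rule injI)
  fix v w assume eq: "A2_to_P1P1 v = A2_to_P1P1 w"
  obtain r t r' t' where vw: "v = (r, t)" "w = (r', t')" by (cases v, cases w)
  have "((r, 1), (t, 1)) \<in> hcoords2 (A2_to_P1P1 (r, t))"
    using normalized_mem_hcoords2[of "(r, t)"] by simp
  then have "((r, 1), (t, 1)) \<in> hcoords2 (A2_to_P1P1 (r', t'))"
    using eq by (simp only: vw)
  then show "v = w"
    by (auto simp: hcoords2_chart vw)
qed

text \<open>
  Bihomogeneity. It makes the vanishing of a form, and the quotient of two forms of equal bidegree,
  independent of the choice of homogeneous coordinates.
\<close>

lemma biform_scale:
  "biform d e c ((a * x0, a * x1), (b * y0, b * y1)) = a ^ d * b ^ e * biform d e c ((x0, x1), (y0, y1))"
proof -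
  have scale: "(a * x0) ^ i * (a * x1) ^ (d - i) = a ^ d * (x0 ^ i * x1 ^ (d - i))"
    if "i \<le> d" for i d and a x0 x1 :: qbar
  proof -
    have "(a * x0) ^ i * (a * x1) ^ (d - i) = a ^ i * a ^ (d - i) * (x0 ^ i * x1 ^ (d - i))"
      by (simp add: power_mult_distrib mult_ac)
    then show ?thesis
      using that by (simp flip: power_add)
  qed
  have "of_rat (c i j) * ((a * x0) ^ i * (a * x1) ^ (d - i)) * ((b * y0) ^ j * (b * y1) ^ (e - j)) =
      a ^ d * b ^ e * (of_rat (c i j) * (x0 ^ i * x1 ^ (d - i)) * (y0 ^ j * y1 ^ (e - j)))"
    if "i \<le> d" "j \<le> e" for i j
    unfolding scale[OF that(1)] scale[OF that(2)] by (simp add: mult_ac)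
  then show ?thesis
    unfolding biform_def prod.case sum_distrib_left by (intro sum.cong refl) auto
qed

lemma polyfun_biform: "(\<lambda>w. biform d e c ((fst w, 1), (snd w, 1))) \<in> polyfun"
  unfolding biform_def
  by (simp only: prod.case) (intro polyfun_sum polyfun_mult polyfun_power polyfun_of_rat polyfun_fst
      polyfun_snd polyfun_of_int[of 1, simplified])

lemma biform_on_chart:
  assumes "v \<in> hcoords2 (A2_to_P1P1 (r, t))"
  shows "\<exists>\<mu>. \<mu> \<noteq> 0 \<and> (\<forall>c. biform d e c v = \<mu> * biform d e c ((r, 1), (t, 1)))"
proof -
  obtain a b where "v = ((a * r, a * 1), (b * t, b * 1))" "a \<noteq> 0" "b \<noteq> 0"
    using assms by (auto simp: hcoords2_chart)
  then show ?thesis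
    using biform_scale[of d e _ a r 1 b t 1] by (intro exI[of _ "a ^ d * b ^ e"]) auto
qed

lemma biform_nonzero_on_chart:
  "v \<in> hcoords2 (A2_to_P1P1 w) \<Longrightarrow>
    biform d e c v \<noteq> 0 \<longleftrightarrow> biform d e c ((fst w, 1), (snd w, 1)) \<noteq> 0"
  using biform_on_chart[of v "fst w" "snd w" d e] by auto

text \<open>
  Every sufficiently large degree is allowed, so that two polynomials can be homogenized to the same
  bidegree and their quotient becomes a quotient of forms.
\<close>

lemma polyfun_homogenize:
  assumes "f \<in> polyfun"
  shows "\<exists>N. \<forall>d\<ge>N. \<exists>c. \<forall>w. biform d d c ((fst w, 1), (snd w, 1)) = f w"
proof -
  obtain p where p: "f = eval2 p" using assms by (auto simp: polyfun_def)
  define N where "N = degree p + (\<Sum>j\<le>degree p. degree (coeff p j))"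
  have deg: "degree (coeff p j) \<le> N" for j
  proof (cases "j \<le> degree p")
    case True
    then show ?thesis
      using member_le_sum[of j "{..degree p}" "\<lambda>j. degree (coeff p j)"] by (simp add: N_def)
  qed (simp add: coeff_eq_0)
  have poly_upto: "poly q x = (\<Sum>i\<le>d. coeff q i * x ^ i)" if "degree q \<le> d" for q :: "qbar poly" and x d
    unfolding poly_altdef using that
    by (intro sum.mono_neutral_left) (auto simp: coeff_eq_0)
  have "biform d d (\<lambda>i j. coeff (coeff p j) i) ((r, 1), (t, 1)) = f (r, t)" if d: "N \<le> d" for d r t
  proof -
    let ?p = "map_poly (\<lambda>a. poly (map_poly of_rat a) r) p"
    have "poly ?p t = (\<Sum>j\<le>d. coeff ?p j * t ^ j)"
      using d map_poly_degree_leq[of "\<lambda>a. poly (map_poly of_rat a) r" p]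
      by (intro poly_upto) (auto simp: N_def)
    also have "\<dots> = (\<Sum>j\<le>d. (\<Sum>i\<le>d. of_rat (coeff (coeff p j) i) * r ^ i) * t ^ j)"
    proof (intro sum.cong refl)
      fix j
      have "degree (map_poly of_rat (coeff p j) :: qbar poly) \<le> d"
        using d deg[of j] map_poly_degree_leq[of of_rat "coeff p j"] by (meson le_trans)
      then show "coeff ?p j * t ^ j = (\<Sum>i\<le>d. of_rat (coeff (coeff p j) i) * r ^ i) * t ^ j"
        by (simp add: coeff_map_poly poly_upto)
    qed
    also have "\<dots> = (\<Sum>i\<le>d. \<Sum>j\<le>d. of_rat (coeff (coeff p j) i) * r ^ i * t ^ j)"
      by (subst sum.swap) (simp add: sum_distrib_right)
    finally show ?thesis
      by (simp add: biform_def p eval2_def)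
  qed
  then show ?thesis by (intro exI[of _ N]) auto
qed

lemma topspace_zariski_P1P1 [simp]: "topspace zariski_P1P1 = UNIV"
proof -
  have "biform 0 0 (\<lambda>_ _. 1) v \<noteq> 0" for v
    by (cases v) (auto simp: biform_def)
  then show ?thesis
    unfolding zariski_P1P1_def topology_generated_by_topspace by blast
qed

lemma openin_zariski_P1P1_nonzero:
  "openin zariski_P1P1 {z. \<forall>v\<in>hcoords2 z. biform d e c v \<noteq> 0}"
  unfolding zariski_P1P1_def by (rule topology_generated_by_Basis) blast

text \<open>
  The form \<open>x1 * y1\<close> cuts out the complement of the affine chart.
\<close>

lemma openin_chart_image_nonzero:
  assumes "f \<in> polyfun"
  shows "openin zariski_P1P1 (A2_to_P1P1 ` {w. f w \<noteq> 0})"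
proof -
  obtain d c where c: "\<And>w. biform d d c ((fst w, 1), (snd w, 1)) = f w"
    using polyfun_homogenize[OF assms] by blast
  define c1 :: "nat \<Rightarrow> nat \<Rightarrow> rat" where "c1 = (\<lambda>i j. if i = 0 \<and> j = 0 then 1 else 0)"
  have c1: "biform 1 1 c1 ((x0, x1), (y0, y1)) = x1 * y1" for x0 x1 y0 y1
    by (simp add: biform_def c1_def)
  have "A2_to_P1P1 ` {w. f w \<noteq> 0} =
    {z. \<forall>v\<in>hcoords2 z. biform 1 1 c1 v \<noteq> 0} \<inter> {z. \<forall>v\<in>hcoords2 z. biform d d c v \<noteq> 0}"
  proof (intro equalityI subsetI)
    fix z assume "z \<in> A2_to_P1P1 ` {w. f w \<noteq> 0}"
    then obtain w where w: "z = A2_to_P1P1 w" "f w \<noteq> 0" by blast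
    have "biform 1 1 c1 v \<noteq> 0 \<and> biform d d c v \<noteq> 0" if "v \<in> hcoords2 z" for v
      using that w(2) unfolding w(1) by (simp add: biform_nonzero_on_chart c c1 del: One_nat_def)
    then show "z \<in> {z. \<forall>v\<in>hcoords2 z. biform 1 1 c1 v \<noteq> 0} \<inter> {z. \<forall>v\<in>hcoords2 z. biform d d c v \<noteq> 0}"
      by blast
  next
    fix z assume z: "z \<in> {z. \<forall>v\<in>hcoords2 z. biform 1 1 c1 v \<noteq> 0} \<inter> {z. \<forall>v\<in>hcoords2 z. biform d d c v \<noteq> 0}"
    obtain x0 x1 y0 y1 where v: "((x0, x1), (y0, y1)) \<in> hcoords2 z"
      using hcoords2_nonempty[of z] by fastforce
    have nz: "biform 1 1 c1 ((x0, x1), (y0, y1)) \<noteq> 0" "biform d d c ((x0, x1), (y0, y1)) \<noteq> 0"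
      using z v by blast+
    then have eq: "z = A2_to_P1P1 (x0 / x1, y0 / y1)"
      using chart_eq_if_mem_hcoords2[OF v] by (simp add: c1 del: One_nat_def)
    have "f (x0 / x1, y0 / y1) \<noteq> 0"
      using nz(2) biform_nonzero_on_chart[OF v[unfolded eq]] c by metis
    then show "z \<in> A2_to_P1P1 ` {w. f w \<noteq> 0}"
      using eq by blast
  qed
  then show ?thesis
    using openin_zariski_P1P1_nonzero by auto
qed

text \<open>
  Together with continuity this says that the chart is an open embedding.
\<close>

lemma openin_chart_image:
  assumes "openin zariski_A2 W"
  shows "openin zariski_P1P1 (A2_to_P1P1 ` W)"
proof (subst openin_subopen, intro ballI)
  fix z assume "z \<in> A2_to_P1P1 ` W"
  then obtain w where w: "w \<in> W" "z = A2_to_P1P1 w" by blast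
  obtain f where "f \<in> polyfun" "f w \<noteq> 0" "{w. f w \<noteq> 0} \<subseteq> W"
    using zariski_A2_basis[OF assms w(1)] by blast
  then show "\<exists>T. openin zariski_P1P1 T \<and> z \<in> T \<and> T \<subseteq> A2_to_P1P1 ` W"
    using openin_chart_image_nonzero w(2) by (intro exI[of _ "A2_to_P1P1 ` {w. f w \<noteq> 0}"]) auto
qed

lemma continuous_map_chart: "continuous_map zariski_A2 zariski_P1P1 A2_to_P1P1"
proof -
  have "openin zariski_A2 (A2_to_P1P1 -` {z. \<forall>v\<in>hcoords2 z. biform d e c v \<noteq> 0})" for d e c
  proof -
    have "(\<forall>v\<in>hcoords2 (A2_to_P1P1 w). biform d e c v \<noteq> 0) \<longleftrightarrow> biform d e c ((fst w, 1), (snd w, 1)) \<noteq> 0" for w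
      using biform_nonzero_on_chart[of _ w d e c] hcoords2_nonempty[of "A2_to_P1P1 w"] by blast
    then have "A2_to_P1P1 -` {z. \<forall>v\<in>hcoords2 z. biform d e c v \<noteq> 0} = {w. biform d e c ((fst w, 1), (snd w, 1)) \<noteq> 0}"
      by auto
    then show ?thesis
      using openin_zariski_A2_nonzero[OF polyfun_biform] by simp
  qed
  moreover have "A2_to_P1P1 ` UNIV \<subseteq> \<Union> {{z. \<forall>v\<in>hcoords2 z. biform d e c v \<noteq> 0} | d e c. True}"
    using topspace_zariski_P1P1 unfolding zariski_P1P1_def topology_generated_by_topspace by blast
  ultimately show ?thesis
    unfolding zariski_P1P1_def by (intro continuous_on_generated_topo) auto
qed

lemma morphism_on_chart: "morphism_on A2 P1P1 UNIV A2_to_P1P1"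
proof -
  have "h \<circ> A2_to_P1P1 \<in> regular_A2 Z"
    if Z: "A2_to_P1P1 ` Z \<subseteq> Z'" and h: "h \<in> regular_P1P1 Z'" for Z Z' h
    unfolding regular_A2_iff
  proof
    fix z assume "z \<in> Z"
    with Z have "A2_to_P1P1 z \<in> Z'" by blast
    then obtain W d e a b where W: "openin zariski_P1P1 W" "A2_to_P1P1 z \<in> W"
      and "\<forall>w\<in>W \<inter> Z'. \<forall>v\<in>hcoords2 w.
        biform d e b v \<noteq> 0 \<and> h w = biform d e a v / biform d e b v"
      using h unfolding regular_P1P1_def by blast
    then have h: "biform d e b v \<noteq> 0 \<and> h w = biform d e a v / biform d e b v"
      if "w \<in> W \<inter> Z'" "v \<in> hcoords2 w" for w v
      using that by blast
    let ?f = "\<lambda>c w. biform d e c ((fst w, 1), (snd w, 1))"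
    let ?W = "{w. A2_to_P1P1 w \<in> W}"
    have "openin zariski_A2 ?W"
      using openin_continuous_map_preimage[OF continuous_map_chart W(1)] by simp
    moreover have "?f b w \<noteq> 0 \<and> (h \<circ> A2_to_P1P1) w = ?f a w / ?f b w" if "w \<in> ?W \<inter> Z" for w
    proof -
      have "A2_to_P1P1 w \<in> W \<inter> Z'"
        using that Z by blast
      then show ?thesis
        unfolding comp_apply by (rule h[OF _ normalized_mem_hcoords2])
    qed
    ultimately show "\<exists>W. openin zariski_A2 W \<and> z \<in> W \<and>
        (\<exists>f\<in>polyfun. \<exists>g\<in>polyfun. \<forall>w\<in>W \<inter> Z. g w \<noteq> 0 \<and> (h \<circ> A2_to_P1P1) w = f w / g w)"
      using W(2)
      by (intro exI[of _ ?W] conjI)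
        (blast, blast, rule bexI[OF bexI[OF _ polyfun_biform[of d e b]] polyfun_biform[of d e a]], blast)
  qed
  then show ?thesis
    using continuous_map_chart by (intro morphism_onI) (simp_all add: A2_def P1P1_def)
qed

abbreviation unchart :: "P1 \<times> P1 \<Rightarrow> qbar \<times> qbar" where
  "unchart \<equiv> inv_into UNIV A2_to_P1P1"

lemma morphism_on_chart_inverse:
  "morphism_on P1P1 A2 (range A2_to_P1P1) unchart"
proof -
  note [simp] = inv_f_f[OF inj_chart]
  have "continuous_map (subtopology zariski_P1P1 (range A2_to_P1P1)) zariski_A2 unchart"
  proof -
    have "openin (subtopology zariski_P1P1 (range A2_to_P1P1))
        {z \<in> range A2_to_P1P1. unchart z \<in> W}" if "openin zariski_A2 W" for W
    proof -
      have "{z \<in> range A2_to_P1P1. unchart z \<in> W} = A2_to_P1P1 ` W \<inter> range A2_to_P1P1"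
        by auto
      then show ?thesis
        using openin_chart_image[OF that] unfolding openin_subtopology by blast
    qed
    then show ?thesis
      by (simp add: continuous_map_def)
  qed
  moreover have "h \<circ> unchart \<in> regular_P1P1 Z"
    if Z: "Z \<subseteq> range A2_to_P1P1" "unchart ` Z \<subseteq> Z'" and h: "h \<in> regular_A2 Z'" for Z Z' h
    unfolding regular_P1P1_def mem_Collect_eq
  proof
    fix z assume "z \<in> Z"
    then obtain w0 where w0: "z = A2_to_P1P1 w0" using Z by blast
    then have "w0 \<in> Z'" using Z \<open>z \<in> Z\<close> by fastforce
    then obtain W f g where W: "openin zariski_A2 W" "w0 \<in> W"
      and fg: "f \<in> polyfun" "g \<in> polyfun"
      and h: "\<And>w. w \<in> W \<inter> Z' \<Longrightarrow> g w \<noteq> 0 \<and> h w = f w / g w"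
      by (rule regular_A2E[OF h]) (rule that)
    obtain M where "\<forall>d\<ge>M. \<exists>a. \<forall>w. biform d d a ((fst w, 1), (snd w, 1)) = f w"
      using polyfun_homogenize[OF fg(1)] by blast
    moreover obtain N where "\<forall>d\<ge>N. \<exists>b. \<forall>w. biform d d b ((fst w, 1), (snd w, 1)) = g w"
      using polyfun_homogenize[OF fg(2)] by blast
    moreover define d where "d = max M N"
    ultimately obtain a b where
      a: "\<And>w. biform d d a ((fst w, 1), (snd w, 1)) = f w" and
      b: "\<And>w. biform d d b ((fst w, 1), (snd w, 1)) = g w"
      by (metis max.cobounded1 max.cobounded2)
    have "biform d d b v \<noteq> 0 \<and> (h \<circ> unchart) w = biform d d a v / biform d d b v"
      if wv: "w \<in> A2_to_P1P1 ` W \<inter> Z" "v \<in> hcoords2 w" for w v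
    proof -
      obtain u where "w = A2_to_P1P1 u" "u \<in> W" using wv(1) by blast
      then obtain r t where w: "w = A2_to_P1P1 (r, t)" "(r, t) \<in> W" by (cases u) auto
      have "unchart w \<in> Z'" using Z(2) wv(1) by blast
      then have "(r, t) \<in> Z'" by (simp add: w(1))
      moreover obtain \<mu> where "\<mu> \<noteq> 0" "\<And>c. biform d d c v = \<mu> * biform d d c ((r, 1), (t, 1))"
        using biform_on_chart[of v r t d d] wv(2) w(1) by blast
      ultimately show ?thesis
        using h[of "(r, t)"] w a[of "(r, t)"] b[of "(r, t)"] by auto
    qed
    then show "\<exists>W d e a b. openin zariski_P1P1 W \<and> z \<in> W \<and>
        (\<forall>w\<in>W \<inter> Z. \<forall>v\<in>hcoords2 w. biform d e b v \<noteq> 0 \<and>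
          (h \<circ> unchart) w = biform d e a v / biform d e b v)"
      using openin_chart_image[OF W(1)] W(2) w0
      by (intro exI[of _ "A2_to_P1P1 ` W"] exI[of _ d] exI[of _ a] exI[of _ b]) auto
  qed
  ultimately show ?thesis
    by (intro morphism_onI) (simp_all add: A2_def P1P1_def)
qed

section \<open>The two-sided recursion\<close>

lemma ev_0 [simp]: "ev 0 x = 0" and ev_1 [simp]: "ev 1 x = 1"
  by (simp_all add: ev_def)

lemma ev_add: "ev (p + q) x = ev p x + ev q x"
  by (simp add: ev_def map_poly_add_hom)

lemma ev_mult: "ev (p * q) x = ev p x * ev q x"
  by (simp add: ev_def map_poly_mult_hom)

lemma ev_diff: "ev (p - q) x = ev p x - ev q x"
  using ev_add[of "p - q" q x] by (simp add: algebra_simps)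

lemma ev_not_identically_0:
  assumes "p \<noteq> 0"
  obtains x where "ev p x \<noteq> 0"
proof -
  have "map_poly of_int p \<noteq> (0 :: qbar poly)"
    using assms by (subst map_poly_eq_0_iff) auto
  then show ?thesis
    using that poly_all_0_iff_0[of "map_poly of_int p :: qbar poly"] by (auto simp: ev_def)
qed

lemma ev_fpoly_rec: "ev (fpoly (j + 1)) x = x * ev (fpoly j) x - ev (fpoly (j - 1)) x"
proof -
  have "ev (fpoly (j + 1)) x - x * ev (fpoly j) x + ev (fpoly (j - 1)) x =
      ev (fpoly (j + 1) - [:0, 1:] * fpoly j + fpoly (j - 1)) x"
    unfolding ev_add ev_diff ev_mult by (simp add: ev_pCons)
  also have "\<dots> = 0"
    unfolding fpoly_rec by simp
  finally have "ev (fpoly (j + 1)) x - (x * ev (fpoly j) x - ev (fpoly (j - 1)) x) = 0"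
    by (simp only: diff_diff_eq2 diff_add_eq)
  then show ?thesis
    by (simp only: right_minus_eq)
qed

lemma ev_fpoly_rec_down: "ev (fpoly (j - 1)) x = x * ev (fpoly j) x - ev (fpoly (j + 1)) x"
  by (simp add: ev_fpoly_rec)

lemma ev_gpoly: "ev (gpoly j) x = ev (fpoly j) x - ev (fpoly (j - 1)) x"
  by (simp add: gpoly_def ev_diff)

lemma ev_gpoly_Suc: "ev (gpoly (j + 1)) x = ev (gpoly j) x + (x - 2) * ev (fpoly j) x"
  unfolding ev_gpoly ev_fpoly_rec by (simp add: algebra_simps)

lemma ev_fpoly_2: "ev (fpoly j) 2 = of_int j"
proof -
  have "ev (fpoly j) 2 = of_int j \<and> ev (fpoly (j - 1)) 2 = of_int (j - 1)"
  proof (induction j rule: int_induct[where k = 0])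
    case base
    show ?case using ev_fpoly_rec_down[of 0 2] by (simp add: fpoly_0 fpoly_1)
  next
    case (step1 i)
    then show ?case using ev_fpoly_rec[of i 2] by simp
  next
    case (step2 i)
    then show ?case using ev_fpoly_rec_down[of "i - 1" 2] by simp
  qed
  then show ?thesis ..
qed

lemma fpoly_nonzero: "j \<noteq> 0 \<Longrightarrow> fpoly j \<noteq> 0"
  using ev_fpoly_2[of j] by auto

lemma fpoly_nonzero_away_from_2:
  assumes "j \<noteq> 0"
  obtains x where "x \<noteq> 2" "ev (fpoly j) x \<noteq> 0"
proof -
  have "[:-2, 1:] * fpoly j \<noteq> 0"
    unfolding mult_eq_0_iff using fpoly_nonzero[OF assms] by simp
  then obtain x where "ev ([:-2, 1:] * fpoly j) x \<noteq> 0"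
    by (rule ev_not_identically_0)
  then show ?thesis
    using that[of x] unfolding ev_mult by (auto simp: ev_pCons)
qed

lemma ev_gpoly_2: "ev (gpoly j) 2 = 1"
  by (simp add: ev_gpoly ev_fpoly_2)

lemma gpoly_nonzero: "gpoly j \<noteq> 0"
  using ev_gpoly_2[of j] by auto

text \<open>
  By the recursion a common zero of two consecutive polynomials would be a zero of all of them,
  including \<open>fpoly 1 = 1\<close>.
\<close>

lemma fpoly_no_common_zero:
  "\<not> (ev (fpoly j) x = 0 \<and> ev (fpoly (j - 1)) x = 0)"
proof (induction j rule: int_induct[where k = 1])
  case base
  show ?case by (simp add: fpoly_1)
next
  case (step1 i)
  then show ?case using ev_fpoly_rec[of i x] by auto
next
  case (step2 i)
  then show ?case using ev_fpoly_rec[of "i - 1" x] by auto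
qed

text \<open>
  The difference of two consecutive \<open>gpoly\<close> is \<open>x - 2\<close> times an \<open>fpoly\<close>, and \<open>gpoly\<close> takes the
  value 1 at 2. So a common zero would be a zero of \<open>fpoly j\<close> and hence of \<open>fpoly (j - 1)\<close>.
\<close>

lemma gpoly_no_common_zero:
  "\<not> (ev (gpoly (j + 1)) x = 0 \<and> ev (gpoly j) x = 0)"
proof
  assume zero: "ev (gpoly (j + 1)) x = 0 \<and> ev (gpoly j) x = 0"
  then have "x \<noteq> 2"
    using ev_gpoly_2[of j] by auto
  then have "ev (fpoly j) x = 0"
    using zero ev_gpoly_Suc[of j x] by auto
  moreover from this have "ev (fpoly (j - 1)) x = 0"
    using zero ev_gpoly[of j x] by simp
  ultimately show False
    using fpoly_no_common_zero by blast
qed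

lemma Phi_cases:
  obtains (even) j where "k = 2 * j" "Phi (- k) = fpoly (- j)" "Phi (k + 1) = gpoly (j + 1)" "Phi (k - 1) = gpoly j"
  | (odd) j where "k = 2 * j - 1" "Phi (- k) = gpoly (1 - j)" "Phi (k + 1) = fpoly j" "Phi (k - 1) = fpoly (j - 1)"
proof (cases "even k")
  case True
  then obtain j where j: "k = 2 * j" by blast
  have "- k = 2 * (- j)" "k + 1 = 2 * (j + 1) - 1" "k - 1 = 2 * j - 1"
    by (simp_all add: j)
  then show ?thesis
    using that(1)[OF j] Phi_even Phi_odd by metis
next
  case False
  then obtain i where i: "k = 2 * i + 1" by (elim oddE)
  define j where "j = i + 1"
  have j: "k = 2 * j - 1" by (simp add: j_def i)
  have "- k = 2 * (1 - j) - 1" "k + 1 = 2 * j" "k - 1 = 2 * (j - 1)"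
    by (simp_all add: j)
  then show ?thesis
    using that(2)[OF j] Phi_even Phi_odd by metis
qed

text \<open>
  For odd \<open>k\<close> both factors are of type \<open>gpoly\<close>; for \<open>k = 2 * j\<close> they are \<open>fpoly (- j)\<close> and
  \<open>x - 2\<close> times \<open>fpoly j\<close>, which are nonzero because \<open>j \<noteq> 0\<close>.
\<close>

lemma Phi_times_Psi_nonzero:
  assumes "k \<noteq> 0"
  shows "Phi (- k) * Psi k \<noteq> 0"
proof (cases k rule: Phi_cases)
  case (even j)
  have "j \<noteq> 0" using assms even(1) by simp
  then obtain x where "x \<noteq> 2" "ev (fpoly j) x \<noteq> 0"
    by (rule fpoly_nonzero_away_from_2)
  then have "ev (Psi k) x \<noteq> 0"
    by (simp add: Psi_def even(3,4) ev_diff ev_gpoly_Suc)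
  then have "Psi k \<noteq> 0" by auto
  moreover have "Phi (- k) \<noteq> 0"
    using \<open>j \<noteq> 0\<close> by (simp add: even(2) fpoly_nonzero)
  ultimately show ?thesis by simp
next
  case (odd j)
  have "Psi k = gpoly j"
    using odd by (simp add: Psi_def gpoly_def)
  then show ?thesis
    using odd(2) by (simp add: gpoly_nonzero)
qed

lemma Phi_no_common_zero:
  "\<not> (ev (Phi (k + 1)) x = 0 \<and> ev (Phi (k - 1)) x = 0)"
  by (cases k rule: Phi_cases) (simp_all add: fpoly_no_common_zero gpoly_no_common_zero)

section \<open>The equations of the two curves and the birational map\<close>

definition C_fun :: "int \<Rightarrow> int \<Rightarrow> qbar \<times> qbar \<Rightarrow> qbar" where
  "C_fun k n w =
     ev (fpoly n) (t_coord k w) * (ev (Phi (- k)) (fst w) * ev (Phi (k - 1)) (fst w) * (snd w - fst w) - 1)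
       + ev (fpoly (n - 1)) (t_coord k w)"

text \<open>
  The equation of the affine part of \<open>D(k, 2n)\<close>, rewritten by means of
  \<open>\<Phi>\<^sub>2\<^sub>n\<^sub>+\<^sub>1 = \<Phi>\<^sub>2\<^sub>n\<^sub>-\<^sub>1 + (t - 2) f\<^sub>n\<close> so that it can be compared with the equation of \<open>C(k, 2n)\<close>.
\<close>

definition D_fun :: "int \<Rightarrow> int \<Rightarrow> qbar \<times> qbar \<Rightarrow> qbar" where
  "D_fun k n w =
     ev (Psi k) (fst w) * ev (gpoly n) (snd w)
       - ev (Phi (k - 1)) (fst w) * (snd w - 2) * ev (fpoly n) (snd w)"

lemma t_coord_alt: "t_coord k w = ev (Phi (- k) * Psi k) (fst w) * (snd w - fst w) + 2"
  by (cases w) (simp add: t_coord_def ev_mult)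

lemma polyfun_t_coord: "t_coord k \<in> polyfun"
  unfolding t_coord_alt[abs_def]
  by (intro polyfun_add polyfun_mult polyfun_diff polyfun_ev polyfun_fst polyfun_snd
      polyfun_of_int[of 2, simplified])

lemma polyfun_C_fun: "C_fun k n \<in> polyfun"
  unfolding C_fun_def[abs_def]
  by (intro polyfun_add polyfun_mult polyfun_diff polyfun_ev polyfun_t_coord polyfun_fst polyfun_snd
      polyfun_of_int[of 1, simplified])

lemma polyfun_D_fun: "D_fun k n \<in> polyfun"
  unfolding D_fun_def[abs_def]
  by (intro polyfun_add polyfun_mult polyfun_diff polyfun_ev polyfun_fst polyfun_snd
      polyfun_of_int[of 2, simplified])

lemma C_set_alt: "C_set k (2 * n) = {w. C_fun k n w = 0}"
  by (auto simp: C_set_def C_fun_def Let_def)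

lemma D_affine_alt: "D_affine k (2 * n) = {w. D_fun k n w = 0}"
proof -
  have "Phi (2 * n + 1) = gpoly (n + 1)"
    using Phi_odd[of "n + 1"] by (simp add: algebra_simps)
  moreover have "D_fun k n (r, t) =
      ev (Phi (k + 1)) r * ev (gpoly n) t - ev (Phi (k - 1)) r * ev (gpoly (n + 1)) t" for r t
    unfolding D_fun_def Psi_def ev_diff ev_gpoly_Suc by (simp add: algebra_simps)
  ultimately show ?thesis
    by (auto simp: D_affine_def Phi_odd)
qed

text \<open>
  The identity behind the proposition: substituting the new coordinate into the equation of \<open>D\<close>
  gives the equation of \<open>C\<close> times \<open>\<Psi>\<^sub>k(r)\<close>, up to sign.
\<close>

lemma D_fun_t_coord: "D_fun k n (fst w, t_coord k w) = - ev (Psi k) (fst w) * C_fun k n w"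
  by (simp add: D_fun_def C_fun_def t_coord_alt ev_gpoly ev_mult algebra_simps)

text \<open>
  On the diagonal the coordinate \<open>t\<close> is 2, where \<open>fpoly n\<close> has the value \<open>n\<close>. As every vertical line
  meets the diagonal, \<open>C\<close> contains no vertical line.
\<close>

lemma C_fun_diagonal: "C_fun k n (r, r) = -1"
  by (simp add: C_fun_def t_coord_alt ev_fpoly_2)

lemma C_fun_not_identically_0_on_fibre: "\<exists>y. C_fun k n (r, y) \<noteq> 0"
  by (rule exI[of _ r]) (simp add: C_fun_diagonal)

text \<open>
  At \<open>t = 2\<close> the equation has the value \<open>\<Psi>\<^sub>k(r)\<close>. If this is zero, then \<open>\<Phi>\<^sub>k\<^sub>+\<^sub>1(r) = \<Phi>\<^sub>k\<^sub>-\<^sub>1(r)\<close> is not,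
  and what remains is a nonzero multiple of \<open>(t - 2) f\<^sub>n(t)\<close>.
\<close>

lemma D_fun_not_identically_0_on_fibre:
  assumes "n \<noteq> 0"
  shows "\<exists>t. D_fun k n (r, t) \<noteq> 0"
proof (cases "ev (Psi k) r = 0")
  case False
  then have "D_fun k n (r, 2) \<noteq> 0"
    by (simp add: D_fun_def ev_gpoly_2)
  then show ?thesis ..
next
  case True
  then have "ev (Phi (k - 1)) r \<noteq> 0"
    using Phi_no_common_zero[of k r] by (auto simp: Psi_def ev_diff)
  moreover obtain t where "t \<noteq> 2" "ev (fpoly n) t \<noteq> 0"
    using assms by (rule fpoly_nonzero_away_from_2)
  ultimately have "D_fun k n (r, t) \<noteq> 0"
    using True by (simp add: D_fun_def)
  then show ?thesis ..
qed

text \<open>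
  Passing to the closure adds points at infinity only: an affine curve is closed in the chart, and
  the chart is open.
\<close>

lemma closure_of_chart_image:
  assumes "f \<in> polyfun"
  shows "A2_to_P1P1 w \<in> zariski_P1P1 closure_of (A2_to_P1P1 ` {w. f w = 0}) \<longleftrightarrow> f w = 0"
proof
  assume cl: "A2_to_P1P1 w \<in> zariski_P1P1 closure_of (A2_to_P1P1 ` {w. f w = 0})"
  show "f w = 0"
  proof (rule ccontr)
    assume "f w \<noteq> 0"
    then have "A2_to_P1P1 w \<in> A2_to_P1P1 ` {w. f w \<noteq> 0}" by blast
    with openin_chart_image_nonzero[OF assms] cl
    have "\<exists>z. z \<in> A2_to_P1P1 ` {w. f w = 0} \<and> z \<in> A2_to_P1P1 ` {w. f w \<noteq> 0}"
      unfolding in_closure_of by meson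
    then obtain w1 w2 where "A2_to_P1P1 w1 = A2_to_P1P1 w2" "f w1 = 0" "f w2 \<noteq> 0"
      by (elim exE conjE imageE) auto
    then show False
      using injD[OF inj_chart] by metis
  qed
next
  assume "f w = 0"
  then show "A2_to_P1P1 w \<in> zariski_P1P1 closure_of (A2_to_P1P1 ` {w. f w = 0})"
    using closure_of_subset[of "A2_to_P1P1 ` {w. f w = 0}" zariski_P1P1] by auto
qed

theorem proposition4p4:
  fixes k l :: int
  assumes "even l" and "k * l \<noteq> 0"
  shows "birational_morphism (curve_C k l) (curve_D k l) (CD_map k)"
proof -
  obtain n where l: "l = 2 * n" using \<open>even l\<close> by blast
  have "k \<noteq> 0" "n \<noteq> 0" using assms(2) by (auto simp: l)
  define s where "s = Phi (- k) * Psi k"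
  have "s \<noteq> 0" using Phi_times_Psi_nonzero[OF \<open>k \<noteq> 0\<close>] by (simp add: s_def)
  let ?C = "{w. C_fun k n w = 0}" and ?Da = "{w. D_fun k n w = 0}"
  let ?D = "zariski_P1P1 closure_of (A2_to_P1P1 ` ?Da)"
  let ?U = "{w. C_fun k n w = 0 \<and> ev s (fst w) \<noteq> 0}"
  let ?Va = "{w. D_fun k n w = 0 \<and> ev s (fst w) \<noteq> 0}"
  let ?V = "A2_to_P1P1 ` ?Va"
  have C: "curve_C k l = subvar A2 ?C"
    by (simp add: curve_C_def l C_set_alt)
  have D: "curve_D k l = subvar P1P1 ?D"
    by (simp add: curve_D_def l D_affine_alt P1P1_def)
  \<comment> \<open>The map of the proposition in affine coordinates, and its inverse
    \<open>y = r + (t - 2) / s(r)\<close> off the zeros of \<open>s\<close>, with a common denominator.\<close>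
  define \<alpha> where "\<alpha> = (\<lambda>w. (fst w, t_coord k w))"
  define \<beta> where "\<beta> = (\<lambda>w. (fst w, (ev s (fst w) * fst w + snd w - 2) / ev s (fst w)))"
  have s_fst: "(\<lambda>w. ev s (fst w)) \<in> polyfun" by blast

  have CD_map: "CD_map k = A2_to_P1P1 \<circ> \<alpha>"
    by (auto simp: CD_map_def A2_to_P1P1_def \<alpha>_def)
  have "morphism_on A2 A2 UNIV \<alpha>"
    using morphism_on_fibre_coordinate_change[OF polyfun_of_int[of 1] polyfun_t_coord[of k]]
    by (simp add: \<alpha>_def)
  then have \<phi>: "morphism_on A2 P1P1 UNIV (CD_map k)"
    unfolding CD_map by (rule morphism_on_compose[OF _ morphism_on_chart]) simp
  have "morphism_on A2 A2 {w. ev s (fst w) \<noteq> 0} \<beta>"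
    unfolding \<beta>_def
    by (intro morphism_on_fibre_coordinate_change s_fst polyfun_add polyfun_mult polyfun_diff
        polyfun_fst polyfun_snd polyfun_of_int[of 2, simplified])
  then have "morphism_on A2 A2 ?Va \<beta>"
    by (rule morphism_on_subset) blast
  moreover have "morphism_on P1P1 A2 ?V unchart"
    by (rule morphism_on_subset[OF morphism_on_chart_inverse]) blast
  ultimately have \<psi>: "morphism_on P1P1 A2 ?V (\<beta> \<circ> unchart)"
    by (intro morphism_on_compose) (auto simp: inv_f_f[OF inj_chart])

  have t_s: "t_coord k w = ev s (fst w) * (snd w - fst w) + 2" for w
    unfolding s_def by (rule t_coord_alt)
  have chart_D: "A2_to_P1P1 w \<in> ?D \<longleftrightarrow> D_fun k n w = 0" for w
    by (rule closure_of_chart_image[OF polyfun_D_fun])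
  have \<alpha>_D: "D_fun k n (\<alpha> w) = 0" if "C_fun k n w = 0" for w
    using that by (simp add: \<alpha>_def D_fun_t_coord)
  have \<beta>\<alpha>: "\<beta> (\<alpha> w) = w" and \<alpha>\<beta>: "\<alpha> (\<beta> w) = w" if "ev s (fst w) \<noteq> 0" for w
    using that by (auto simp: \<alpha>_def \<beta>_def t_s prod_eq_iff field_simps)
  have \<beta>_C: "C_fun k n (\<beta> w) = 0" if "D_fun k n w = 0" "ev s (fst w) \<noteq> 0" for w
  proof -
    \<comment> \<open>Where \<open>s\<close> is nonzero, so is its factor \<open>\<Psi>\<^sub>k\<close>, which can be cancelled.\<close>
    have "ev (Psi k) (fst w) * C_fun k n (\<beta> w) = 0"
      using D_fun_t_coord[of k n "\<beta> w"] \<alpha>\<beta>[OF that(2)] that(1) by (simp add: \<alpha>_def \<beta>_def)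
    then show ?thesis
      using that(2) by (auto simp: s_def ev_mult)
  qed

  have "morphism (curve_C k l) (curve_D k l) (CD_map k)"
    unfolding C D
  proof (rule morphism_subvar[OF \<phi>])
    show "CD_map k ` ?C \<subseteq> ?D"
      by (intro image_subsetI) (simp only: CD_map comp_apply chart_D mem_Collect_eq \<alpha>_D)
  qed simp
  moreover have "dense_open (curve_C k l) ?U"
  proof -
    have "openin (subtopology zariski_A2 ?C) ?U"
      using openin_zariski_A2_nonzero[OF s_fst] unfolding openin_subtopology by blast
    moreover have "?C \<subseteq> zariski_A2 closure_of ?U"
      using polyfun_C_fun \<open>s \<noteq> 0\<close> C_fun_not_identically_0_on_fibre
      by (rule curve_subset_closure_of_generic_fibres)
    ultimately show ?thesis
      unfolding C by (intro dense_open_subvar) (auto simp: A2_def)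
  qed
  moreover have "dense_open (curve_D k l) ?V"
  proof -
    have "?V = A2_to_P1P1 ` {w. ev s (fst w) \<noteq> 0} \<inter> ?D"
      using chart_D by blast
    then have "openin (subtopology zariski_P1P1 ?D) ?V"
      using openin_chart_image_nonzero[OF s_fst] unfolding openin_subtopology by blast
    \<comment> \<open>The curve is the closure of its affine part, so density need be checked there only.\<close>
    moreover have "?D \<subseteq> zariski_P1P1 closure_of ?V"
    proof (rule closure_of_minimal)
      have "?Da \<subseteq> zariski_A2 closure_of ?Va"
        using polyfun_D_fun \<open>s \<noteq> 0\<close> D_fun_not_identically_0_on_fibre[OF \<open>n \<noteq> 0\<close>]
        by (rule curve_subset_closure_of_generic_fibres)
      then show "A2_to_P1P1 ` ?Da \<subseteq> zariski_P1P1 closure_of ?V"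
        using continuous_map_image_closure_subset[OF continuous_map_chart, of ?Va] by blast
    qed simp
    ultimately show ?thesis
      unfolding D by (intro dense_open_subvar) (simp_all add: P1P1_def)
  qed
  moreover have "isomorphism (subvar (curve_C k l) ?U) (subvar (curve_D k l) ?V) (CD_map k)"
  proof -
    have U: "subvar (curve_C k l) ?U = subvar A2 ?U"
      unfolding C subvar_subvar by (rule arg_cong[of _ _ "subvar A2"]) blast
    have V: "subvar (curve_D k l) ?V = subvar P1P1 ?V"
      unfolding D subvar_subvar by (rule arg_cong[of _ _ "subvar P1P1"]) (use chart_D in blast)
    have fst_\<alpha>: "fst (\<alpha> w) = fst w" and fst_\<beta>: "fst (\<beta> w) = fst w" for w
      by (simp_all add: \<alpha>_def \<beta>_def)
    have "morphism (subvar A2 ?U) (subvar P1P1 ?V) (CD_map k)"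
    proof (rule morphism_subvar[OF \<phi>])
      show "CD_map k ` ?U \<subseteq> ?V"
        using \<alpha>_D fst_\<alpha> unfolding CD_map by (intro image_subsetI) simp
    qed simp
    moreover have "morphism (subvar P1P1 ?V) (subvar A2 ?U) (\<beta> \<circ> unchart)"
    proof (rule morphism_subvar[OF \<psi>])
      show "(\<beta> \<circ> unchart) ` ?V \<subseteq> ?U"
        using \<beta>_C fst_\<beta> unfolding image_image by (intro image_subsetI) (simp add: inv_f_f[OF inj_chart])
    qed simp
    ultimately show ?thesis
      unfolding U V
    proof (rule isomorphism_subvar)
      show "(\<beta> \<circ> unchart) (CD_map k w) = w" if "w \<in> ?U" for w
        using that by (simp add: CD_map inv_f_f[OF inj_chart] \<beta>\<alpha>)
      show "CD_map k ((\<beta> \<circ> unchart) z) = z" if z: "z \<in> ?V" for z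
      proof -
        obtain w where "z = A2_to_P1P1 w" "ev s (fst w) \<noteq> 0" using z by blast
        then show ?thesis
          by (simp add: CD_map inv_f_f[OF inj_chart] \<alpha>\<beta>)
      qed
    qed
  qed
  ultimately show ?thesis
    unfolding birational_morphism_def by blast
qed

end
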